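(* Let $k\ge 1$ and let $\Lambda$ be a row-finite $k$-graph without sources, with talented monoid $T_\Lambda$. Then: (i) $\Lambda$ has a nontrivial loop without an entrance if and only if there exist $0\neq a\in T_\Lambda$ and $\mathbf{n}\in\mathbb{Z}^k_{<0}$ such that ${}^{\mathbf{n}}a=a$. (ii) $\Lambda$ has a loop with an entrance if and only if there exist $a\in T_\Lambda$ and $\mathbf{n}\in\mathbb{N}^k$ such that ${}^{\mathbf{n}}a<a$. (iii) $\Lambda$ has a nontrivial loop if and only if there exist $0\neq a\in T_\Lambda$ and $\mathbf{n}\in\mathbb{N}^k\setminus\{0\}$ such that ${}^{\mathbf{n}}a\le a$.
   Context: $\mathbb{N}=\{0,1,2,\dots\}$; $\mathbb{Z}^k$ has the coordinatewise order; $\mathbf{e}_i$ is the $i$-th unit vector; $\mathbb{Z}^k_{<0}$ is the set of $k$-tuples of nonpositive integers excluding the zero tuple. A $k$-graph is a countable small category $\Lambda$ with a functor $d:\Lambda\to\mathbb{N}^k$ (degree) such that whenever $d(\lambda)=\mathbf{n}+\mathbf{m}$ with $\mathbf{n},\mathbf{m}\in\mathbb{N}^k$ there are unique $\alpha,\beta\in\Lambda$ with $d(\alpha)=\mathbf{n}$, $d(\beta)=\mathbf{m}$, $\lambda=\alpha\beta$. The codomain and domain of a morphism (path) $\lambda$ are written $r(\lambda)$ and $s(\lambda)$; $\lambda\mu$ is defined when $s(\lambda)=r(\mu)$. $\Lambda^{\mathbf{n}}=d^{-1}(\mathbf{n})$; elements of $\Lambda^0$ are identified with objects and called vertices. $v\Lambda=\{\lambda: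 r(\lambda)=v\}$, $v\Lambda^{\mathbf{n}}=v\Lambda\cap\Lambda^{\mathbf{n}}$. $\Lambda$ is row-finite without sources if $0<|v\Lambda^{\mathbf{n}}|<\infty$ for all $v\in\Lambda^0$, $\mathbf{n}\in\mathbb{N}^k$. For $0\le\mathbf{n}\le\mathbf{m}\le d(\lambda)$, $\lambda(\mathbf{n},\mathbf{m})$ is the unique path of degree $\mathbf{m}-\mathbf{n}$ with $\lambda=\alpha\,\lambda(\mathbf{n},\mathbf{m})\,\beta$, $d(\alpha)=\mathbf{n}$, $d(\beta)=d(\lambda)-\mathbf{m}$. A loop is a path $\mu$ with $r(\mu)=s(\mu)$; it is nontrivial if it is not a vertex. An entrance to a loop $\mu$ is a path $\lambda\in s(\mu)\Lambda$ with $d(\lambda)\le d(\mu)$ and $\mu(0,d(\lambda))\ne\lambda$. The talented monoid $T_\Lambda$ is the commutative monoid generated by symbols $v(\mathbf{n})$ ($v\in\Lambda^0$, $\mathbf{n}\in\mathbb{Z}^k$) subject to $v(\mathbf{n})=\sum_{\alpha\in v\Lambda^{\mathbf{e}_i}}s(\alpha)(\mathbf{n}+\mathbf{e}_i)$ for all $v,\mathbf{n}$ and $1\le i\le k$. $\mathbb{Z}^k$ acts on it by monoid automorphisms with ${}^{\mathbf{q}}v(\mathbf{n})=v(\mathbf{n}+\mathbf{q})$. The algebraic pre-order is $x\le y\iff y=x+z$ for some $z$; $x<y$ means $x\le y$ and $x\neq y$. *)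

theory Defs
  imports
    "HOL-Analysis.Finite_Cartesian_Product"
    "HOL-Library.Multiset"
    "HOL-Library.Countable_Set"
    "HOL-Algebra.Group"
begin

section \<open>Higher-rank graphs\<close>

text \<open>Degrees live in \<open>nat ^ 'k\<close>, so the rank is \<open>CARD('k) \<ge> 1\<close>. A path \<open>cmp \<Lambda> \<xi> \<mu>\<close> is
  written \<open>\<xi>\<mu>\<close> in the literature and is meaningful when \<open>src \<Lambda> \<xi> = rng \<Lambda> \<mu>\<close>.\<close>

record ('o, 'm, 'k) kgraph =
  objs :: "'o set"
  paths :: "'m set"
  rng :: "'m \<Rightarrow> 'o"
  src :: "'m \<Rightarrow> 'o"
  ident :: "'o \<Rightarrow> 'm"
  cmp :: "'m \<Rightarrow> 'm \<Rightarrow> 'm"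
  deg :: "'m \<Rightarrow> nat ^ 'k"

locale small_category =
  fixes \<Lambda> :: "('o, 'm, 'k::finite) kgraph"
  assumes rng_closed: "\<xi> \<in> paths \<Lambda> \<Longrightarrow> rng \<Lambda> \<xi> \<in> objs \<Lambda>"
    and src_closed: "\<xi> \<in> paths \<Lambda> \<Longrightarrow> src \<Lambda> \<xi> \<in> objs \<Lambda>"
    and ident_closed: "v \<in> objs \<Lambda> \<Longrightarrow> ident \<Lambda> v \<in> paths \<Lambda>"
    and rng_ident: "v \<in> objs \<Lambda> \<Longrightarrow> rng \<Lambda> (ident \<Lambda> v) = v"
    and src_ident: "v \<in> objs \<Lambda> \<Longrightarrow> src \<Lambda> (ident \<Lambda> v) = v"
    and cmp_closed: "\<lbrakk>\<xi> \<in> paths \<Lambda>; \<mu> \<in> paths \<Lambda>; src \<Lambda> \<xi> = rng \<Lambda> \<mu>\<rbrakk> \<Longrightarrow> cmp \<Lambda> \<xi> \<mu> \<in> paths \<Lambda>"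
    and rng_cmp: "\<lbrakk>\<xi> \<in> paths \<Lambda>; \<mu> \<in> paths \<Lambda>; src \<Lambda> \<xi> = rng \<Lambda> \<mu>\<rbrakk> \<Longrightarrow> rng \<Lambda> (cmp \<Lambda> \<xi> \<mu>) = rng \<Lambda> \<xi>"
    and src_cmp: "\<lbrakk>\<xi> \<in> paths \<Lambda>; \<mu> \<in> paths \<Lambda>; src \<Lambda> \<xi> = rng \<Lambda> \<mu>\<rbrakk> \<Longrightarrow> src \<Lambda> (cmp \<Lambda> \<xi> \<mu>) = src \<Lambda> \<mu>"
    and ident_cmp: "\<xi> \<in> paths \<Lambda> \<Longrightarrow> cmp \<Lambda> (ident \<Lambda> (rng \<Lambda> \<xi>)) \<xi> = \<xi>"
    and cmp_ident: "\<xi> \<in> paths \<Lambda> \<Longrightarrow> cmp \<Lambda> \<xi> (ident \<Lambda> (src \<Lambda> \<xi>)) = \<xi>"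
    and cmp_assoc: "\<lbrakk>\<xi> \<in> paths \<Lambda>; \<mu> \<in> paths \<Lambda>; \<nu> \<in> paths \<Lambda>;
        src \<Lambda> \<xi> = rng \<Lambda> \<mu>; src \<Lambda> \<mu> = rng \<Lambda> \<nu>\<rbrakk>
        \<Longrightarrow> cmp \<Lambda> (cmp \<Lambda> \<xi> \<mu>) \<nu> = cmp \<Lambda> \<xi> (cmp \<Lambda> \<mu> \<nu>)"

locale k_graph = small_category \<Lambda> for \<Lambda> :: "('o, 'm, 'k::finite) kgraph" +
  assumes countable_objs: "countable (objs \<Lambda>)"
    and countable_paths: "countable (paths \<Lambda>)"
    and deg_ident: "v \<in> objs \<Lambda> \<Longrightarrow> deg \<Lambda> (ident \<Lambda> v) = 0"
    and deg_cmp: "\<lbrakk>\<xi> \<in> paths \<Lambda>; \<mu> \<in> paths \<Lambda>; src \<Lambda> \<xi> = rng \<Lambda> \<mu>\<rbrakk>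
        \<Longrightarrow> deg \<Lambda> (cmp \<Lambda> \<xi> \<mu>) = deg \<Lambda> \<xi> + deg \<Lambda> \<mu>"
    and factorization: "\<lbrakk>\<xi> \<in> paths \<Lambda>; deg \<Lambda> \<xi> = n + m\<rbrakk>
        \<Longrightarrow> \<exists>!(\<alpha>, \<beta>). \<alpha> \<in> paths \<Lambda> \<and> \<beta> \<in> paths \<Lambda> \<and> src \<Lambda> \<alpha> = rng \<Lambda> \<beta> \<and>
              deg \<Lambda> \<alpha> = n \<and> deg \<Lambda> \<beta> = m \<and> \<xi> = cmp \<Lambda> \<alpha> \<beta>"

definition paths_of_deg :: "('o, 'm, 'k::finite) kgraph \<Rightarrow> nat ^ 'k \<Rightarrow> 'm set" where
  "paths_of_deg \<Lambda> n = {\<xi> \<in> paths \<Lambda>. deg \<Lambda> \<xi> = n}"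

definition paths_from :: "('o, 'm, 'k::finite) kgraph \<Rightarrow> 'o \<Rightarrow> nat ^ 'k \<Rightarrow> 'm set" where
  "paths_from \<Lambda> v n = {\<xi> \<in> paths_of_deg \<Lambda> n. rng \<Lambda> \<xi> = v}"

definition row_finite_without_sources :: "('o, 'm, 'k::finite) kgraph \<Rightarrow> bool" where
  "row_finite_without_sources \<Lambda> \<longleftrightarrow>
    (\<forall>v \<in> objs \<Lambda>. \<forall>n. paths_from \<Lambda> v n \<noteq> {} \<and> finite (paths_from \<Lambda> v n))"

text \<open>The middle factor \<open>\<xi>(n,m)\<close>, to be used only for \<open>n \<le> m \<le> deg \<Lambda> \<xi>\<close>.\<close>

definition segment :: "('o, 'm, 'k::finite) kgraph \<Rightarrow> 'm \<Rightarrow> nat ^ 'k \<Rightarrow> nat ^ 'k \<Rightarrow> 'm" where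
  "segment \<Lambda> \<xi> n m = (THE \<gamma>. \<gamma> \<in> paths_of_deg \<Lambda> (m - n) \<and>
     (\<exists>\<alpha> \<in> paths_of_deg \<Lambda> n. \<exists>\<beta> \<in> paths_of_deg \<Lambda> (deg \<Lambda> \<xi> - m).
        src \<Lambda> \<alpha> = rng \<Lambda> \<gamma> \<and> src \<Lambda> \<gamma> = rng \<Lambda> \<beta> \<and> \<xi> = cmp \<Lambda> \<alpha> (cmp \<Lambda> \<gamma> \<beta>)))"

definition is_loop :: "('o, 'm, 'k::finite) kgraph \<Rightarrow> 'm \<Rightarrow> bool" where
  "is_loop \<Lambda> \<mu> \<longleftrightarrow> \<mu> \<in> paths \<Lambda> \<and> rng \<Lambda> \<mu> = src \<Lambda> \<mu>"

text \<open>Vertices, regarded as paths, are the elements of degree \<open>0\<close>; these are exactly the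
  identity morphisms (lemma \<open>paths_of_deg_0\<close> below).\<close>

definition nontrivial_loop :: "('o, 'm, 'k::finite) kgraph \<Rightarrow> 'm \<Rightarrow> bool" where
  "nontrivial_loop \<Lambda> \<mu> \<longleftrightarrow> is_loop \<Lambda> \<mu> \<and> \<mu> \<notin> paths_of_deg \<Lambda> 0"

definition is_entrance :: "('o, 'm, 'k::finite) kgraph \<Rightarrow> 'm \<Rightarrow> 'm \<Rightarrow> bool" where
  "is_entrance \<Lambda> \<mu> \<xi> \<longleftrightarrow> \<xi> \<in> paths \<Lambda> \<and> rng \<Lambda> \<xi> = src \<Lambda> \<mu> \<and>
     deg \<Lambda> \<xi> \<le> deg \<Lambda> \<mu> \<and> segment \<Lambda> \<mu> 0 (deg \<Lambda> \<xi>) \<noteq> \<xi>"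

definition has_entrance :: "('o, 'm, 'k::finite) kgraph \<Rightarrow> 'm \<Rightarrow> bool" where
  "has_entrance \<Lambda> \<mu> \<longleftrightarrow> (\<exists>\<xi>. is_entrance \<Lambda> \<mu> \<xi>)"

context k_graph
begin

lemma paths_of_deg_0: "paths_of_deg \<Lambda> 0 = ident \<Lambda> ` objs \<Lambda>"
proof (intro equalityI subsetI)
  fix \<xi> assume "\<xi> \<in> paths_of_deg \<Lambda> 0"
  then have l: "\<xi> \<in> paths \<Lambda>" "deg \<Lambda> \<xi> = 0" by (auto simp: paths_of_deg_def)
  let ?P = "\<lambda>(\<alpha>, \<beta>). \<alpha> \<in> paths \<Lambda> \<and> \<beta> \<in> paths \<Lambda> \<and> src \<Lambda> \<alpha> = rng \<Lambda> \<beta> \<and>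
              deg \<Lambda> \<alpha> = 0 \<and> deg \<Lambda> \<beta> = 0 \<and> \<xi> = cmp \<Lambda> \<alpha> \<beta>"
  have "\<exists>!p. ?P p" using factorization[of \<xi> 0 0] l by simp
  moreover have "?P (\<xi>, ident \<Lambda> (src \<Lambda> \<xi>))" "?P (ident \<Lambda> (rng \<Lambda> \<xi>), \<xi>)"
    using l by (auto simp: ident_closed src_closed rng_closed rng_ident src_ident
        deg_ident ident_cmp cmp_ident)
  ultimately have "(\<xi>, ident \<Lambda> (src \<Lambda> \<xi>)) = (ident \<Lambda> (rng \<Lambda> \<xi>), \<xi>)" by blast
  then show "\<xi> \<in> ident \<Lambda> ` objs \<Lambda>" using l rng_closed by blast
qed (auto simp: paths_of_deg_def ident_closed deg_ident)

lemma segment_ex1: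
  assumes "\<xi> \<in> paths \<Lambda>" "n \<le> m" "m \<le> deg \<Lambda> \<xi>"
  shows "\<exists>!\<gamma>. \<gamma> \<in> paths_of_deg \<Lambda> (m - n) \<and>
     (\<exists>\<alpha> \<in> paths_of_deg \<Lambda> n. \<exists>\<beta> \<in> paths_of_deg \<Lambda> (deg \<Lambda> \<xi> - m).
        src \<Lambda> \<alpha> = rng \<Lambda> \<gamma> \<and> src \<Lambda> \<gamma> = rng \<Lambda> \<beta> \<and> \<xi> = cmp \<Lambda> \<alpha> (cmp \<Lambda> \<gamma> \<beta>))"
    (is "\<exists>!\<gamma>. ?P \<gamma>")
proof -
  have e1: "deg \<Lambda> \<xi> = n + (deg \<Lambda> \<xi> - n)" and e2: "deg \<Lambda> \<xi> - n = (m - n) + (deg \<Lambda> \<xi> - m)"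
    using assms(2,3) unfolding vec_eq_iff less_eq_vec_def vector_add_component vector_minus_component
    by (metis le_add_diff_inverse le_trans, metis Nat.add_diff_assoc2 add.commute le_add_diff_inverse)
  have u1: "\<exists>!(\<alpha>, \<beta>). \<alpha> \<in> paths \<Lambda> \<and> \<beta> \<in> paths \<Lambda> \<and> src \<Lambda> \<alpha> = rng \<Lambda> \<beta> \<and>
              deg \<Lambda> \<alpha> = n \<and> deg \<Lambda> \<beta> = deg \<Lambda> \<xi> - n \<and> \<xi> = cmp \<Lambda> \<alpha> \<beta>"
    using factorization[OF assms(1) e1] .
  then obtain \<alpha> \<delta> where a: "\<alpha> \<in> paths \<Lambda>" "\<delta> \<in> paths \<Lambda>" "src \<Lambda> \<alpha> = rng \<Lambda> \<delta>"
      "deg \<Lambda> \<alpha> = n" "deg \<Lambda> \<delta> = deg \<Lambda> \<xi> - n" "\<xi> = cmp \<Lambda> \<alpha> \<delta>"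
    by auto
  have u2: "\<exists>!(\<gamma>, \<beta>). \<gamma> \<in> paths \<Lambda> \<and> \<beta> \<in> paths \<Lambda> \<and> src \<Lambda> \<gamma> = rng \<Lambda> \<beta> \<and>
              deg \<Lambda> \<gamma> = m - n \<and> deg \<Lambda> \<beta> = deg \<Lambda> \<xi> - m \<and> \<delta> = cmp \<Lambda> \<gamma> \<beta>"
    using factorization[OF a(2)] a(5) e2 by simp
  then obtain \<gamma> \<beta> where g: "\<gamma> \<in> paths \<Lambda>" "\<beta> \<in> paths \<Lambda>" "src \<Lambda> \<gamma> = rng \<Lambda> \<beta>"
      "deg \<Lambda> \<gamma> = m - n" "deg \<Lambda> \<beta> = deg \<Lambda> \<xi> - m" "\<delta> = cmp \<Lambda> \<gamma> \<beta>"
    by auto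
  show ?thesis
  proof (rule ex1I[of _ \<gamma>])
    have "src \<Lambda> \<alpha> = rng \<Lambda> \<gamma>" using a(3) g rng_cmp by metis
    then show "?P \<gamma>" using a g unfolding paths_of_deg_def by blast
  next
    fix \<gamma>' assume "?P \<gamma>'"
    then obtain \<alpha>' \<beta>' where h: "\<gamma>' \<in> paths \<Lambda>" "\<alpha>' \<in> paths \<Lambda>" "\<beta>' \<in> paths \<Lambda>"
        "deg \<Lambda> \<gamma>' = m - n" "deg \<Lambda> \<alpha>' = n" "deg \<Lambda> \<beta>' = deg \<Lambda> \<xi> - m"
        "src \<Lambda> \<alpha>' = rng \<Lambda> \<gamma>'" "src \<Lambda> \<gamma>' = rng \<Lambda> \<beta>'" "\<xi> = cmp \<Lambda> \<alpha>' (cmp \<Lambda> \<gamma>' \<beta>')"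
      by (auto simp: paths_of_deg_def)
    have c: "cmp \<Lambda> \<gamma>' \<beta>' \<in> paths \<Lambda>" "rng \<Lambda> (cmp \<Lambda> \<gamma>' \<beta>') = src \<Lambda> \<alpha>'"
        "deg \<Lambda> (cmp \<Lambda> \<gamma>' \<beta>') = deg \<Lambda> \<xi> - n"
      using h e2 by (auto simp: cmp_closed rng_cmp deg_cmp)
    have unique: "p = q" if "\<exists>!p. P p" "P p" "P q" for P and p q :: "'m \<times> 'm"
      using that by blast
    have "(\<alpha>', cmp \<Lambda> \<gamma>' \<beta>') = (\<alpha>, \<delta>)"
      by (rule unique[OF u1], unfold case_prod_conv) (use a h c in metis)+
    then have d: "\<delta> = cmp \<Lambda> \<gamma>' \<beta>'" by simp
    have "(\<gamma>', \<beta>') = (\<gamma>, \<beta>)"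
      by (rule unique[OF u2], unfold case_prod_conv) (use g h d in metis)+
    then show "\<gamma>' = \<gamma>" by simp
  qed
qed

end


section \<open>Commutative monoids by generators and relations\<close>

text \<open>The free commutative monoid on \<open>G\<close> consists of the finite multisets over \<open>G\<close>.\<close>

inductive_set pres_cong :: "'a set \<Rightarrow> ('a multiset \<times> 'a multiset) set
    \<Rightarrow> ('a multiset \<times> 'a multiset) set"
  for G :: "'a set" and R :: "('a multiset \<times> 'a multiset) set" where
  rel: "\<lbrakk>(x, y) \<in> R; set_mset x \<subseteq> G; set_mset y \<subseteq> G\<rbrakk> \<Longrightarrow> (x, y) \<in> pres_cong G R"
| refl: "set_mset x \<subseteq> G \<Longrightarrow> (x, x) \<in> pres_cong G R"
| sym: "(x, y) \<in> pres_cong G R \<Longrightarrow> (y, x) \<in> pres_cong G R"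
| trans: "\<lbrakk>(x, y) \<in> pres_cong G R; (y, z) \<in> pres_cong G R\<rbrakk> \<Longrightarrow> (x, z) \<in> pres_cong G R"
| add: "\<lbrakk>(x, y) \<in> pres_cong G R; set_mset z \<subseteq> G\<rbrakk> \<Longrightarrow> (x + z, y + z) \<in> pres_cong G R"

text \<open>The operation is written multiplicatively in the monoid record: \<open>\<otimes>\<close> is the addition and
  \<open>\<one>\<close> is the zero element of the presented monoid.\<close>

definition pres_monoid :: "'a set \<Rightarrow> ('a multiset \<times> 'a multiset) set
    \<Rightarrow> 'a multiset set monoid" where
  "pres_monoid G R =
     \<lparr>carrier = {x. set_mset x \<subseteq> G} // pres_cong G R,
      mult = (\<lambda>X Y. \<Union>x\<in>X. \<Union>y\<in>Y. pres_cong G R `` {x + y}),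
      one = pres_cong G R `` {{#}}\<rparr>"

lemma pres_cong_dom:
  "(x, y) \<in> pres_cong G R \<Longrightarrow> set_mset x \<subseteq> G \<and> set_mset y \<subseteq> G"
  by (induction rule: pres_cong.induct) auto

lemma equiv_pres_cong: "equiv {x. set_mset x \<subseteq> G} (pres_cong G R)"
proof (rule equivI)
  show "pres_cong G R \<subseteq> {x. set_mset x \<subseteq> G} \<times> {x. set_mset x \<subseteq> G}"
    using pres_cong_dom by fastforce
  show "refl_on {x. set_mset x \<subseteq> G} (pres_cong G R)"
    by (auto intro!: refl_onI pres_cong.refl)
  show "Relation.sym (pres_cong G R)" by (auto intro: symI pres_cong.sym)
  show "Relation.trans (pres_cong G R)" by (auto intro: transI pres_cong.trans)
qed

lemma pres_cong_add2:
  assumes "(x, x') \<in> pres_cong G R" "(y, y') \<in> pres_cong G R"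
  shows "(x + y, x' + y') \<in> pres_cong G R"
proof -
  have "(x + y, x' + y) \<in> pres_cong G R"
    using assms pres_cong_dom pres_cong.add by blast
  moreover have "(y + x', y' + x') \<in> pres_cong G R"
    using assms pres_cong_dom pres_cong.add by blast
  ultimately show ?thesis by (metis add.commute pres_cong.trans)
qed

lemma pres_mult_class:
  assumes "set_mset x \<subseteq> G" "set_mset y \<subseteq> G"
  shows "(pres_cong G R `` {x}) \<otimes>\<^bsub>pres_monoid G R\<^esub> (pres_cong G R `` {y})
    = pres_cong G R `` {x + y}"
proof -
  have "pres_cong G R `` {x' + y'} = pres_cong G R `` {x + y}"
    if "(x, x') \<in> pres_cong G R" "(y, y') \<in> pres_cong G R" for x' y'
    using pres_cong_add2[OF that] equiv_class_eq[OF equiv_pres_cong] by metis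
  then have "(\<Union>x'\<in>pres_cong G R `` {x}. \<Union>y'\<in>pres_cong G R `` {y}. pres_cong G R `` {x' + y'})
      = (\<Union>x'\<in>pres_cong G R `` {x}. \<Union>y'\<in>pres_cong G R `` {y}. pres_cong G R `` {x + y})"
    by (intro SUP_cong) (simp_all only: Image_singleton_iff)
  moreover have "pres_cong G R `` {x} \<noteq> {}" "pres_cong G R `` {y} \<noteq> {}"
    using equiv_class_self[OF equiv_pres_cong] assms by blast+
  ultimately show ?thesis unfolding pres_monoid_def by (simp del: Image_singleton_iff)
qed

lemma pres_carrierE:
  assumes "X \<in> carrier (pres_monoid G R)"
  obtains x where "set_mset x \<subseteq> G" "X = pres_cong G R `` {x}"
  using assms by (auto simp: pres_monoid_def elim!: quotientE)

lemma pres_carrierI: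
  "set_mset x \<subseteq> G \<Longrightarrow> pres_cong G R `` {x} \<in> carrier (pres_monoid G R)"
  by (auto simp: pres_monoid_def intro: quotientI)

lemma pres_one: "\<one>\<^bsub>pres_monoid G R\<^esub> = pres_cong G R `` {{#}}"
  by (simp add: pres_monoid_def)

lemma comm_monoid_pres_monoid: "comm_monoid (pres_monoid G R)"
proof (rule comm_monoidI)
  show "\<one>\<^bsub>pres_monoid G R\<^esub> \<in> carrier (pres_monoid G R)"
    by (simp add: pres_one pres_carrierI)
qed (auto elim!: pres_carrierE simp: pres_mult_class pres_one pres_carrierI ac_simps)


section \<open>The talented monoid\<close>

text \<open>The generator \<open>v(n)\<close> is encoded as the pair \<open>(v, n)\<close>; \<open>axis i 1\<close> is the \<open>i\<close>-th unit
  vector.\<close>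

definition talented_gens :: "('o, 'm, 'k::finite) kgraph \<Rightarrow> ('o \<times> (int ^ 'k)) set" where
  "talented_gens \<Lambda> = objs \<Lambda> \<times> UNIV"

definition talented_rels :: "('o, 'm, 'k::finite) kgraph
    \<Rightarrow> (('o \<times> (int ^ 'k)) multiset \<times> ('o \<times> (int ^ 'k)) multiset) set" where
  "talented_rels \<Lambda> =
     {({#(v, n)#}, image_mset (\<lambda>\<alpha>. (src \<Lambda> \<alpha>, n + axis i 1)) (mset_set (paths_from \<Lambda> v (axis i 1))))
      | v n i. v \<in> objs \<Lambda>}"

abbreviation talented_cong :: "('o, 'm, 'k::finite) kgraph
    \<Rightarrow> (('o \<times> (int ^ 'k)) multiset \<times> ('o \<times> (int ^ 'k)) multiset) set" where
  "talented_cong \<Lambda> \<equiv> pres_cong (talented_gens \<Lambda>) (talented_rels \<Lambda>)"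

definition talented_monoid :: "('o, 'm, 'k::finite) kgraph
    \<Rightarrow> ('o \<times> (int ^ 'k)) multiset set monoid" where
  "talented_monoid \<Lambda> = pres_monoid (talented_gens \<Lambda>) (talented_rels \<Lambda>)"

definition shift :: "int ^ 'k \<Rightarrow> ('o \<times> (int ^ 'k::finite)) multiset \<Rightarrow> ('o \<times> (int ^ 'k)) multiset" where
  "shift q = image_mset (\<lambda>(v, n). (v, n + q))"

text \<open>The action of \<open>q\<close> on a class; independent of representatives by
  \<open>talented_act_class\<close> below.\<close>

definition talented_act :: "('o, 'm, 'k::finite) kgraph \<Rightarrow> int ^ 'k
    \<Rightarrow> ('o \<times> (int ^ 'k)) multiset set \<Rightarrow> ('o \<times> (int ^ 'k)) multiset set" where
  "talented_act \<Lambda> q X = (\<Union>x\<in>X. talented_cong \<Lambda> `` {shift q x})"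

definition alg_le :: "('a, 'b) monoid_scheme \<Rightarrow> 'a \<Rightarrow> 'a \<Rightarrow> bool" where
  "alg_le M x y \<longleftrightarrow> (\<exists>z \<in> carrier M. y = x \<otimes>\<^bsub>M\<^esub> z)"

definition alg_less :: "('a, 'b) monoid_scheme \<Rightarrow> 'a \<Rightarrow> 'a \<Rightarrow> bool" where
  "alg_less M x y \<longleftrightarrow> alg_le M x y \<and> x \<noteq> y"

lemma comm_monoid_talented_monoid: "comm_monoid (talented_monoid \<Lambda>)"
  unfolding talented_monoid_def by (rule comm_monoid_pres_monoid)

lemma shift_gens: "set_mset x \<subseteq> talented_gens \<Lambda> \<Longrightarrow> set_mset (shift q x) \<subseteq> talented_gens \<Lambda>"
  by (auto simp: shift_def talented_gens_def)

lemma shift_add: "shift q (x + y) = shift q x + shift q y"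
  by (simp add: shift_def)

lemma shift_shift: "shift p (shift q x) = shift (p + q) x"
  by (simp add: shift_def multiset.map_comp comp_def case_prod_unfold ac_simps)

lemma shift_0: "shift 0 x = x"
  by (simp add: shift_def)

lemma shift_rels:
  assumes "(x, y) \<in> talented_rels \<Lambda>"
  shows "(shift q x, shift q y) \<in> talented_rels \<Lambda>"
proof -
  obtain v n i where "v \<in> objs \<Lambda>" "x = {#(v, n)#}"
    "y = image_mset (\<lambda>\<alpha>. (src \<Lambda> \<alpha>, n + axis i 1)) (mset_set (paths_from \<Lambda> v (axis i 1)))"
    using assms unfolding talented_rels_def by blast
  moreover from this have "shift q x = {#(v, n + q)#}"
    "shift q y = image_mset (\<lambda>\<alpha>. (src \<Lambda> \<alpha>, (n + q) + axis i 1))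
       (mset_set (paths_from \<Lambda> v (axis i 1)))"
    by (simp_all add: shift_def multiset.map_comp comp_def ac_simps)
  ultimately show ?thesis unfolding talented_rels_def by blast
qed

lemma shift_cong: "(x, y) \<in> talented_cong \<Lambda> \<Longrightarrow> (shift q x, shift q y) \<in> talented_cong \<Lambda>"
proof (induction rule: pres_cong.induct)
  case (rel x y)
  then show ?case by (intro pres_cong.rel shift_rels shift_gens)
next
  case (refl x)
  then show ?case by (intro pres_cong.refl shift_gens)
next
  case (sym x y)
  show ?case by (rule pres_cong.sym[OF sym.IH])
next
  case (trans x y z)
  show ?case by (rule pres_cong.trans[OF trans.IH])
next
  case (add x y z)
  show ?case unfolding shift_add by (rule pres_cong.add[OF add.IH shift_gens[OF add.hyps(2)]])
qed

lemma talented_act_class: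
  assumes "set_mset x \<subseteq> talented_gens \<Lambda>"
  shows "talented_act \<Lambda> q (talented_cong \<Lambda> `` {x}) = talented_cong \<Lambda> `` {shift q x}"
proof -
  have "talented_cong \<Lambda> `` {shift q y} = talented_cong \<Lambda> `` {shift q x}"
    if "(x, y) \<in> talented_cong \<Lambda>" for y
    using shift_cong[OF that] equiv_class_eq[OF equiv_pres_cong] by metis
  moreover have "(x, x) \<in> talented_cong \<Lambda>" using assms by (rule pres_cong.refl)
  ultimately show ?thesis unfolding talented_act_def by blast
qed

lemma talented_act_0:
  "a \<in> carrier (talented_monoid \<Lambda>) \<Longrightarrow> talented_act \<Lambda> 0 a = a"
  unfolding talented_monoid_def
  by (auto elim!: pres_carrierE simp: talented_act_class shift_0)

lemma talented_act_act:
  "a \<in> carrier (talented_monoid \<Lambda>)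
    \<Longrightarrow> talented_act \<Lambda> p (talented_act \<Lambda> q a) = talented_act \<Lambda> (p + q) a"
  unfolding talented_monoid_def
  by (auto elim!: pres_carrierE simp: talented_act_class shift_gens shift_shift)

lemma talented_act_iso: "talented_act \<Lambda> q \<in> iso (talented_monoid \<Lambda>) (talented_monoid \<Lambda>)"
proof -
  let ?T = "talented_monoid \<Lambda>"
  have closed: "talented_act \<Lambda> p a \<in> carrier ?T" if "a \<in> carrier ?T" for p a
    using that unfolding talented_monoid_def
    by (auto elim!: pres_carrierE simp: talented_act_class shift_gens pres_carrierI)
  have "talented_act \<Lambda> q (a \<otimes>\<^bsub>?T\<^esub> b) = talented_act \<Lambda> q a \<otimes>\<^bsub>?T\<^esub> talented_act \<Lambda> q b"
    if "a \<in> carrier ?T" "b \<in> carrier ?T" for a b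
    using that unfolding talented_monoid_def
    by (auto elim!: pres_carrierE
        simp: talented_act_class shift_gens pres_mult_class shift_add)
  then have "talented_act \<Lambda> q \<in> hom ?T ?T" using closed by (auto intro: homI)
  moreover have "bij_betw (talented_act \<Lambda> q) (carrier ?T) (carrier ?T)"
    by (rule bij_betw_byWitness[where f' = "talented_act \<Lambda> (- q)"])
      (auto simp: talented_act_act talented_act_0 closed)
  ultimately show ?thesis by (simp add: iso_def)
qed

lemma (in k_graph) talented_relation:
  assumes "row_finite_without_sources \<Lambda>" "v \<in> objs \<Lambda>"
  shows "talented_cong \<Lambda> `` {{#(v, n)#}} =
    talented_cong \<Lambda> `` {\<Sum>\<alpha> \<in> paths_from \<Lambda> v (axis i 1). {#(src \<Lambda> \<alpha>, n + axis i 1)#}}"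
proof -
  let ?A = "paths_from \<Lambda> v (axis i 1)"
  have fin: "finite ?A" using assms by (simp add: row_finite_without_sources_def)
  let ?y = "image_mset (\<lambda>\<alpha>. (src \<Lambda> \<alpha>, n + axis i 1)) (mset_set ?A)"
  have "({#(v, n)#}, ?y) \<in> talented_rels \<Lambda>" using assms(2) unfolding talented_rels_def by blast
  moreover have "set_mset {#(v, n)#} \<subseteq> talented_gens \<Lambda>" "set_mset ?y \<subseteq> talented_gens \<Lambda>"
    using assms(2) fin src_closed
    by (auto simp: talented_gens_def paths_from_def paths_of_deg_def)
  ultimately have "({#(v, n)#}, ?y) \<in> talented_cong \<Lambda>" by (rule pres_cong.rel)
  moreover have "?y = (\<Sum>\<alpha> \<in> ?A. {#(src \<Lambda> \<alpha>, n + axis i 1)#})"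
    by (simp add: sum_unfold_sum_mset)
  ultimately show ?thesis using equiv_class_eq[OF equiv_pres_cong] by metis
qed

end

theory Submission
  imports Defs
begin

text \<open>Sending a multiset \<open>y\<close> of vertices to the multiset \<open>sources n y\<close> of sources of all paths of
  degree \<open>n\<close> starting in \<open>y\<close> exhibits the talented monoid as a direct limit of free commutative
  monoids: every element is a multiset of vertices placed at one level, and two of them are
  equal iff they become equal at some higher level. So, writing \<open>a\<close> as a multiset \<open>y\<close> placed
  at a high enough level, the translate of \<open>a\<close> by \<open>n \<ge> 0\<close> is \<open>\<le> a\<close>, \<open>< a\<close> or \<open>= a\<close> according as \<open>y\<close> is
  contained in, strictly contained in or equal to \<open>sources n y\<close>. In each case every vertex of the finite multiset
  \<open>y\<close> is reached from a vertex of \<open>y\<close> by a path of degree \<open>n\<close>, so walking backwards produces a loop, and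
  counting paths decides about entrances: a loop \<open>\<mu>\<close> has no entrance iff it is the only path of
  its range and degree.\<close>

section \<open>Degrees as vectors of natural numbers and of integers\<close>

lemma vec_nat_diff_add:
  fixes n m :: "nat ^ 'k::finite"
  assumes "n \<le> m"
  shows "n + (m - n) = m"
  using assms by (simp add: vec_eq_iff less_eq_vec_def)

definition vnat :: "int ^ 'k \<Rightarrow> nat ^ 'k::finite" where
  "vnat n = (\<chi> i. nat (n $ i))"

definition vint :: "nat ^ 'k \<Rightarrow> int ^ 'k::finite" where
  "vint n = (\<chi> i. int (n $ i))"

lemma vint_vnat: "0 \<le> n \<Longrightarrow> vint (vnat n) = n"
  by (simp add: vint_def vnat_def vec_eq_iff less_eq_vec_def)

lemma vint_nonneg: "0 \<le> vint n"
  by (simp add: vint_def less_eq_vec_def)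

lemma vint_0: "vint 0 = 0"
  by (simp add: vint_def vec_eq_iff)

lemma vint_add: "vint (m + n) = vint m + vint n"
  by (simp add: vint_def vec_eq_iff)

lemma vint_eq_0_iff: "vint n = 0 \<longleftrightarrow> n = 0"
  by (simp add: vint_def vec_eq_iff)

lemma vint_axis: "vint (axis i 1) = axis i 1"
  by (simp add: vint_def vec_eq_iff axis_def)

text \<open>Under the bound both differences are nonnegative, so \<open>nat\<close> truncates
  nothing. This splits the way from level \<open>n\<close> up to \<open>M\<close> into a first step
  \<open>m\<close> and the rest.\<close>

lemma vnat_diff_add:
  assumes "n + vint m \<le> M"
  shows "vnat (M - n) = m + vnat (M - (n + vint m))"
proof -
  have "nat (M $ i - n $ i) = m $ i + nat (M $ i - (n $ i + int (m $ i)))" for i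
    using assms by (simp add: vint_def less_eq_vec_def)
      (smt (verit) int_plus nat_int nat_add_distrib of_nat_0_le_iff)
  then show ?thesis by (simp add: vnat_def vint_def vec_eq_iff)
qed

text \<open>Induction on the sum of the coordinates, removing a unit vector at a nonzero coordinate.
  It fits the talented relations, which raise a level by one unit vector at a time.\<close>

lemma vec_nat_induct [case_names 0 add]:
  fixes n :: "nat ^ 'k::finite"
  assumes "P 0" "\<And>n i. P n \<Longrightarrow> P (n + axis i 1)"
  shows "P n"
proof (induction "\<Sum>i\<in>UNIV. n $ i" arbitrary: n)
  case 0
  then have "n = 0" by (simp add: vec_eq_iff)
  then show ?case using assms(1) by simp
next
  case (Suc s)
  then obtain i where i: "n $ i \<noteq> 0" by (metis nat.distinct(1) sum.neutral)
  define m where "m = n - axis i 1"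
  have n: "n = m + axis i 1"
    using i by (auto simp: m_def vec_eq_iff axis_def)
  have "(\<Sum>j\<in>UNIV. n $ j) = (\<Sum>j\<in>UNIV. m $ j) + 1"
    by (simp add: n sum.distrib axis_def)
  then show ?case using Suc assms(2) n by auto
qed

section \<open>Factorizations and entrances in a row-finite graph without sources\<close>

locale row_finite_k_graph = k_graph \<Lambda> for \<Lambda> :: "('o, 'm, 'k::finite) kgraph" +
  assumes row_finite: "row_finite_without_sources \<Lambda>"
begin

lemma finite_paths_from: "v \<in> objs \<Lambda> \<Longrightarrow> finite (paths_from \<Lambda> v n)"
  and paths_from_nonempty: "v \<in> objs \<Lambda> \<Longrightarrow> paths_from \<Lambda> v n \<noteq> {}"
  using row_finite by (auto simp: row_finite_without_sources_def)

lemma src_paths_from: "\<xi> \<in> paths_from \<Lambda> v n \<Longrightarrow> src \<Lambda> \<xi> \<in> objs \<Lambda>"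
  by (auto simp: paths_from_def paths_of_deg_def src_closed)

lemma paths_from_0: "v \<in> objs \<Lambda> \<Longrightarrow> paths_from \<Lambda> v 0 = {ident \<Lambda> v}"
  by (auto simp: paths_from_def paths_of_deg_0 rng_ident)

text \<open>The unique factorization property as a bijection: existence of factors gives
  surjectivity, uniqueness gives injectivity. In this form it reindexes sums over paths.\<close>

lemma bij_betw_cmp:
  "bij_betw (\<lambda>(\<alpha>, \<beta>). cmp \<Lambda> \<alpha> \<beta>)
     (SIGMA \<alpha>:paths_from \<Lambda> v n. paths_from \<Lambda> (src \<Lambda> \<alpha>) m) (paths_from \<Lambda> v (n + m))"
  (is "bij_betw ?f ?A ?B")
proof (rule bij_betw_imageI)
  show "inj_on ?f ?A"
  proof (rule inj_onI, clarify)
    fix \<alpha> \<beta> \<alpha>' \<beta>'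
    assume *: "\<alpha> \<in> paths_from \<Lambda> v n" "\<beta> \<in> paths_from \<Lambda> (src \<Lambda> \<alpha>) m"
      "\<alpha>' \<in> paths_from \<Lambda> v n" "\<beta>' \<in> paths_from \<Lambda> (src \<Lambda> \<alpha>') m"
      "cmp \<Lambda> \<alpha> \<beta> = cmp \<Lambda> \<alpha>' \<beta>'"
    let ?P = "\<lambda>(a, b). a \<in> paths \<Lambda> \<and> b \<in> paths \<Lambda> \<and> src \<Lambda> a = rng \<Lambda> b \<and>
              deg \<Lambda> a = n \<and> deg \<Lambda> b = m \<and> cmp \<Lambda> \<alpha> \<beta> = cmp \<Lambda> a b"
    have "\<exists>!p. ?P p"
      using * by (intro factorization)
        (auto simp: paths_from_def paths_of_deg_def cmp_closed deg_cmp)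
    moreover have "?P (\<alpha>, \<beta>)" "?P (\<alpha>', \<beta>')"
      using * by (auto simp: paths_from_def paths_of_deg_def)
    ultimately have "(\<alpha>, \<beta>) = (\<alpha>', \<beta>')" by blast
    then show "\<alpha> = \<alpha>' \<and> \<beta> = \<beta>'" by simp
  qed
  show "?f ` ?A = ?B"
  proof (intro equalityI subsetI)
    fix \<xi> assume "\<xi> \<in> ?B"
    then have \<xi>: "\<xi> \<in> paths \<Lambda>" "deg \<Lambda> \<xi> = n + m" "rng \<Lambda> \<xi> = v"
      by (auto simp: paths_from_def paths_of_deg_def)
    from factorization[OF \<xi>(1,2)] obtain \<alpha> \<beta> where
      "\<alpha> \<in> paths \<Lambda>" "\<beta> \<in> paths \<Lambda>" "src \<Lambda> \<alpha> = rng \<Lambda> \<beta>"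
      "deg \<Lambda> \<alpha> = n" "deg \<Lambda> \<beta> = m" "\<xi> = cmp \<Lambda> \<alpha> \<beta>"
      by auto
    then show "\<xi> \<in> ?f ` ?A"
      using \<xi>(3) by (intro image_eqI[of _ _ "(\<alpha>, \<beta>)"])
        (auto simp: paths_from_def paths_of_deg_def rng_cmp)
  qed (auto simp: paths_from_def paths_of_deg_def cmp_closed rng_cmp deg_cmp)
qed

lemma segment_cmp:
  assumes "\<xi> \<in> paths \<Lambda>" "\<eta> \<in> paths \<Lambda>" "src \<Lambda> \<xi> = rng \<Lambda> \<eta>"
  shows "segment \<Lambda> (cmp \<Lambda> \<xi> \<eta>) 0 (deg \<Lambda> \<xi>) = \<xi>"
  unfolding segment_def
proof (rule the1_equality[OF segment_ex1], goal_cases)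
  \<comment> \<open>The first three goals are the hypotheses of \<open>segment_ex1\<close>; this one
    asks that \<open>\<xi>\<close> be a middle factor, with an identity on its left and
    \<open>\<eta>\<close> on its right.\<close>
  case 4
  have "ident \<Lambda> (rng \<Lambda> \<xi>) \<in> paths_of_deg \<Lambda> 0" "src \<Lambda> (ident \<Lambda> (rng \<Lambda> \<xi>)) = rng \<Lambda> \<xi>"
    "\<eta> \<in> paths_of_deg \<Lambda> (deg \<Lambda> (cmp \<Lambda> \<xi> \<eta>) - deg \<Lambda> \<xi>)"
    "cmp \<Lambda> \<xi> \<eta> = cmp \<Lambda> (ident \<Lambda> (rng \<Lambda> \<xi>)) (cmp \<Lambda> \<xi> \<eta>)"
    using assms ident_cmp[OF cmp_closed[OF assms]]
    by (auto simp: paths_of_deg_0 rng_closed src_ident deg_cmp rng_cmp)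
      (auto simp: paths_of_deg_def vec_eq_iff)
  moreover have "\<xi> \<in> paths_of_deg \<Lambda> (deg \<Lambda> \<xi> - 0)"
    using assms(1) by (simp add: paths_of_deg_def vec_eq_iff)
  ultimately show ?case using assms(3) by blast
qed (use assms in \<open>auto simp: cmp_closed deg_cmp less_eq_vec_def\<close>)

text \<open>An entrance may have smaller degree than \<open>\<mu>\<close>, but in the absence of
  sources every path from the base vertex of degree at most \<open>deg \<Lambda> \<mu>\<close>
  extends to one of degree exactly \<open>deg \<Lambda> \<mu>\<close>. If that extension can only be
  \<open>\<mu>\<close>, the path is an initial segment of \<open>\<mu>\<close>.\<close>

lemma not_has_entrance_iff:
  assumes "is_loop \<Lambda> \<mu>"
  shows "\<not> has_entrance \<Lambda> \<mu> \<longleftrightarrow> paths_from \<Lambda> (rng \<Lambda> \<mu>) (deg \<Lambda> \<mu>) = {\<mu>}"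
proof
  have \<mu>: "\<mu> \<in> paths \<Lambda>" "src \<Lambda> \<mu> = rng \<Lambda> \<mu>" using assms by (auto simp: is_loop_def)
  have seg: "segment \<Lambda> \<mu> 0 (deg \<Lambda> \<mu>) = \<mu>"
    using segment_cmp[of \<mu> "ident \<Lambda> (src \<Lambda> \<mu>)"] \<mu>
    by (metis cmp_ident ident_closed rng_ident src_closed)
  {
    assume "\<not> has_entrance \<Lambda> \<mu>"
    then have "\<xi> = \<mu>" if "\<xi> \<in> paths_from \<Lambda> (rng \<Lambda> \<mu>) (deg \<Lambda> \<mu>)" for \<xi>
      using that \<mu>(2) seg order.refl[of "deg \<Lambda> \<mu>"]
      unfolding has_entrance_def is_entrance_def paths_from_def paths_of_deg_def mem_Collect_eq
      by metis
    moreover have "\<mu> \<in> paths_from \<Lambda> (rng \<Lambda> \<mu>) (deg \<Lambda> \<mu>)"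
      using \<mu> by (auto simp: paths_from_def paths_of_deg_def)
    ultimately show "paths_from \<Lambda> (rng \<Lambda> \<mu>) (deg \<Lambda> \<mu>) = {\<mu>}" by blast
  next
    assume *: "paths_from \<Lambda> (rng \<Lambda> \<mu>) (deg \<Lambda> \<mu>) = {\<mu>}"
    have "segment \<Lambda> \<mu> 0 (deg \<Lambda> \<xi>) = \<xi>"
      if \<xi>: "\<xi> \<in> paths \<Lambda>" "rng \<Lambda> \<xi> = src \<Lambda> \<mu>" "deg \<Lambda> \<xi> \<le> deg \<Lambda> \<mu>" for \<xi>
    proof -
      obtain \<eta> where "\<eta> \<in> paths_from \<Lambda> (src \<Lambda> \<xi>) (deg \<Lambda> \<mu> - deg \<Lambda> \<xi>)"
        using paths_from_nonempty[OF src_closed[OF \<xi>(1)]] by blast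
      then have \<eta>: "\<eta> \<in> paths \<Lambda>" "src \<Lambda> \<xi> = rng \<Lambda> \<eta>" "deg \<Lambda> \<eta> = deg \<Lambda> \<mu> - deg \<Lambda> \<xi>"
        by (auto simp: paths_from_def paths_of_deg_def)
      then have "cmp \<Lambda> \<xi> \<eta> \<in> paths_from \<Lambda> (rng \<Lambda> \<mu>) (deg \<Lambda> \<mu>)"
        using \<xi> \<mu> by (auto simp: paths_from_def paths_of_deg_def cmp_closed rng_cmp deg_cmp
            vec_nat_diff_add)
      then show ?thesis using * segment_cmp[OF \<xi>(1) \<eta>(1,2)] by auto
    qed
    then show "\<not> has_entrance \<Lambda> \<mu>" by (auto simp: has_entrance_def is_entrance_def)
  }
qed

section \<open>Multisets of sources of paths\<close>

text \<open>With \<open>y\<close> read as a row vector of multiplicities, this is its product with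
  the matrix that counts paths of degree \<open>n\<close> between two vertices.\<close>

definition sources :: "nat ^ 'k \<Rightarrow> 'o multiset \<Rightarrow> 'o multiset" where
  "sources n y = (\<Sum>v\<in>#y. \<Sum>\<alpha>\<in>paths_from \<Lambda> v n. {#src \<Lambda> \<alpha>#})"

lemma sources_empty: "sources n {#} = {#}"
  by (simp add: sources_def)

lemma sources_union: "sources n (y + z) = sources n y + sources n z"
  by (simp add: sources_def)

lemma sources_add_mset: "sources n (add_mset v y) = sources n {#v#} + sources n y"
  by (simp add: sources_def)

lemma sources_single: "sources n {#v#} = (\<Sum>\<alpha>\<in>paths_from \<Lambda> v n. {#src \<Lambda> \<alpha>#})"
  by (simp add: sources_def)

lemma sources_single_image: "sources n {#v#} = image_mset (src \<Lambda>) (mset_set (paths_from \<Lambda> v n))"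
  by (simp add: sources_single sum_unfold_sum_mset)

lemma sources_sum: "finite A \<Longrightarrow> sources n (\<Sum>a\<in>A. f a) = (\<Sum>a\<in>A. sources n (f a))"
  by (induction A rule: finite_induct) (auto simp: sources_empty sources_union)

lemma mem_sources_single_iff:
  "v \<in> objs \<Lambda> \<Longrightarrow> w \<in># sources n {#v#} \<longleftrightarrow> (\<exists>\<alpha>\<in>paths_from \<Lambda> v n. src \<Lambda> \<alpha> = w)"
  by (auto simp: sources_single set_mset_sum finite_paths_from)

lemma size_sources_single: "v \<in> objs \<Lambda> \<Longrightarrow> size (sources n {#v#}) = card (paths_from \<Lambda> v n)"
  by (simp add: sources_single size_multiset_sum)

lemma mem_sources_iff: "w \<in># sources n y \<longleftrightarrow> (\<exists>v\<in>#y. w \<in># sources n {#v#})"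
  by (simp add: sources_def)

lemma sources_objs:
  assumes "set_mset y \<subseteq> objs \<Lambda>"
  shows "set_mset (sources n y) \<subseteq> objs \<Lambda>"
proof
  fix w assume "w \<in># sources n y"
  then obtain v where "v \<in># y" "w \<in># sources n {#v#}" unfolding mem_sources_iff[of w n y] by blast
  then show "w \<in> objs \<Lambda>"
    using assms mem_sources_single_iff[of v w n] src_paths_from by blast
qed

lemma sources_0: "set_mset y \<subseteq> objs \<Lambda> \<Longrightarrow> sources 0 y = y"
proof (induction y)
  case (add v y)
  then show ?case
    by (subst sources_add_mset) (auto simp: sources_single paths_from_0 src_ident)
qed (simp add: sources_empty)

text \<open>Both sides count the same paths: composition matches pairs of paths of degrees
  \<open>n\<close> and \<open>m\<close> with paths of degree \<open>n + m\<close>, and it keeps the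
  final source.\<close>

lemma sources_sources: "set_mset y \<subseteq> objs \<Lambda> \<Longrightarrow> sources m (sources n y) = sources (n + m) y"
proof (induction y)
  case (add v y)
  then have v: "v \<in> objs \<Lambda>" by simp
  have "sources m (sources n {#v#}) =
      (\<Sum>\<alpha>\<in>paths_from \<Lambda> v n. \<Sum>\<beta>\<in>paths_from \<Lambda> (src \<Lambda> \<alpha>) m. {#src \<Lambda> \<beta>#})"
    using v by (simp add: sources_single sources_sum finite_paths_from)
  also have "\<dots> = (\<Sum>(\<alpha>, \<beta>)\<in>(SIGMA \<alpha>:paths_from \<Lambda> v n. paths_from \<Lambda> (src \<Lambda> \<alpha>) m). {#src \<Lambda> \<beta>#})"
    using v by (intro sum.Sigma) (auto simp: finite_paths_from src_paths_from)
  also have "\<dots> = (\<Sum>p\<in>(SIGMA \<alpha>:paths_from \<Lambda> v n. paths_from \<Lambda> (src \<Lambda> \<alpha>) m).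
      {#src \<Lambda> ((\<lambda>(\<alpha>, \<beta>). cmp \<Lambda> \<alpha> \<beta>) p)#})"
    by (intro sum.cong) (auto simp: paths_from_def paths_of_deg_def src_cmp)
  also have "\<dots> = sources (n + m) {#v#}"
    unfolding sources_single by (rule sum.reindex_bij_betw[OF bij_betw_cmp])
  finally show ?case
    using add by (simp add: sources_add_mset[of _ v y] sources_union)
qed (simp add: sources_empty)

text \<open>Absence of sources: each occurrence of a vertex contributes at least one path.\<close>

lemma size_sources_ge: "set_mset y \<subseteq> objs \<Lambda> \<Longrightarrow> size y \<le> size (sources n y)"
proof (induction y)
  case (add v y)
  then have "size (sources n {#v#}) \<ge> 1"
    using finite_paths_from[of v n] paths_from_nonempty[of v n]
    by (simp add: size_sources_single Suc_le_eq card_gt_0_iff)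
  with add show ?case by (simp add: sources_add_mset[of _ v y])
qed simp

lemma sources_eq_empty_iff:
  "set_mset y \<subseteq> objs \<Lambda> \<Longrightarrow> sources n y = {#} \<longleftrightarrow> y = {#}"
  using size_sources_ge[of y n] by (auto simp: sources_empty)

lemma size_sources_mono:
  assumes "set_mset y \<subseteq> objs \<Lambda>" "n \<le> m"
  shows "size (sources n y) \<le> size (sources m y)"
  using size_sources_ge[OF sources_objs[OF assms(1)], of n "m - n"]
    sources_sources[OF assms(1), of "m - n" n] vec_nat_diff_add[OF assms(2)] by simp

lemma sources_power_fixed:
  assumes "set_mset y \<subseteq> objs \<Lambda>" "sources n y = y"
  shows "sources (j *s n) y = y"
proof (induction j)
  case 0
  have "0 *s n = 0" by (simp add: vec_eq_iff vector_scalar_mult_def)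
  then show ?case using sources_0[OF assms(1)] by simp
next
  case (Suc j)
  have "Suc j *s n = j *s n + n" by (simp add: vec_eq_iff vector_scalar_mult_def)
  then show ?case using sources_sources[OF assms(1), of n "j *s n"] Suc assms(2) by simp
qed

section \<open>Loops from multisets contained in their sources\<close>

lemma mem_sources_trans:
  assumes "u \<in> objs \<Lambda>" "v \<in># sources n {#u#}" "w \<in># sources m {#v#}"
  shows "w \<in># sources (n + m) {#u#}"
proof -
  obtain z where "sources n {#u#} = add_mset v z" using assms(2) by (rule mset_add)
  then have "w \<in># sources m (sources n {#u#})"
    using assms(3) by (simp add: sources_add_mset[of _ v z])
  then show ?thesis using assms(1) sources_sources[of "{#u#}" m n] by simp
qed

text \<open>A backward walk inside the finite multiset \<open>y\<close> must revisit a vertex.\<close>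

lemma ex_loop_backwards:
  assumes y: "set_mset y \<subseteq> objs \<Lambda>" and sub: "y \<subseteq># sources n y" and w: "w \<in># y"
  obtains v i j where "v \<in># y" "i > 0" "v \<in># sources (i *s n) {#v#}" "w \<in># sources (j *s n) {#v#}"
proof -
  have "\<exists>u. u \<in># y \<and> v \<in># sources n {#u#}" if "v \<in># y" for v
    using mset_subset_eqD[OF sub that] unfolding mem_sources_iff[of v n y] by blast
  \<comment> \<open>\<open>p\<close> chooses a predecessor inside \<open>y\<close>, so
    \<open>q t\<close> below is the \<open>t\<close>-th predecessor of \<open>w\<close>.\<close>
  then obtain p where p: "\<And>v. v \<in># y \<Longrightarrow> p v \<in># y \<and> v \<in># sources n {#p v#}" by metis
  define q where "q t = (p ^^ t) w" for t
  have q: "q t \<in># y" for t by (induction t) (use w p in \<open>auto simp: q_def\<close>)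
  have walk: "q s \<in># sources (t *s n) {#q (s + t)#}" for s t
  proof (induction t)
    case 0
    have "0 *s n = 0" by (simp add: vec_eq_iff vector_scalar_mult_def)
    then show ?case using q[of s] y by (auto simp: sources_0)
  next
    case (Suc t)
    have "Suc t *s n = n + t *s n" by (simp add: vec_eq_iff vector_scalar_mult_def)
    moreover have "q (s + t) \<in># sources n {#q (s + Suc t)#}"
      using p[OF q[of "s + t"]] by (simp add: q_def)
    ultimately show ?case
      using mem_sources_trans[OF _ _ Suc, of "q (s + Suc t)" n] q[of "s + Suc t"] y by auto
  qed
  have "finite (range q)" using q by (intro finite_subset[OF _ finite_set_mset[of y]]) auto
  then have "\<not> inj q" using finite_imageD by blast
  then obtain s t where "s < t" "q s = q t" by (metis injI nat_neq_iff)
  show ?thesis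
  proof (rule that)
    show "q t \<in># y" "t - s > 0" using q \<open>s < t\<close> by auto
    show "q t \<in># sources ((t - s) *s n) {#q t#}"
      using walk[of s "t - s"] \<open>s < t\<close> \<open>q s = q t\<close> by simp
    show "w \<in># sources (t *s n) {#q t#}" using walk[of 0 t] by (simp add: q_def)
  qed
qed

lemma sources_singleton_eqI:
  assumes "size (sources n {#v#}) = 1" "w \<in># sources n {#v#}"
  shows "sources n {#v#} = {#w#}"
  using assms by (metis One_nat_def add_mset_eq_single mset_add size_1_singleton_mset)

lemma ex_loopI:
  assumes "v \<in> objs \<Lambda>" "v \<in># sources n {#v#}"
  obtains \<mu> where "is_loop \<Lambda> \<mu>" "deg \<Lambda> \<mu> = n" "rng \<Lambda> \<mu> = v"
  using assms(2) unfolding mem_sources_single_iff[OF assms(1)]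
  by (metis (mono_tags, lifting) is_loop_def mem_Collect_eq paths_from_def paths_of_deg_def)

lemma loopD:
  assumes "is_loop \<Lambda> \<mu>"
  shows "rng \<Lambda> \<mu> \<in> objs \<Lambda>" "rng \<Lambda> \<mu> \<in># sources (deg \<Lambda> \<mu>) {#rng \<Lambda> \<mu>#}"
proof -
  show r: "rng \<Lambda> \<mu> \<in> objs \<Lambda>" using assms rng_closed unfolding is_loop_def by blast
  show "rng \<Lambda> \<mu> \<in># sources (deg \<Lambda> \<mu>) {#rng \<Lambda> \<mu>#}"
    unfolding mem_sources_single_iff[OF r] using assms
    by (intro bexI[of _ \<mu>]) (auto simp: is_loop_def paths_from_def paths_of_deg_def)
qed

lemma not_has_entrance_iff_size:
  assumes "is_loop \<Lambda> \<mu>"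
  shows "\<not> has_entrance \<Lambda> \<mu> \<longleftrightarrow> size (sources (deg \<Lambda> \<mu>) {#rng \<Lambda> \<mu>#}) = 1"
proof -
  have "\<mu> \<in> paths_from \<Lambda> (rng \<Lambda> \<mu>) (deg \<Lambda> \<mu>)"
    using assms by (auto simp: is_loop_def paths_from_def paths_of_deg_def)
  then show ?thesis
    unfolding not_has_entrance_iff[OF assms] size_sources_single[OF loopD(1)[OF assms]]
    by (auto simp: card_1_singleton_iff)
qed

lemma nontrivial_loop_iff: "nontrivial_loop \<Lambda> \<mu> \<longleftrightarrow> is_loop \<Lambda> \<mu> \<and> deg \<Lambda> \<mu> \<noteq> 0"
  by (auto simp: nontrivial_loop_def is_loop_def paths_of_deg_def)

lemma scaled_degree_nonzero: "i > 0 \<Longrightarrow> n \<noteq> 0 \<Longrightarrow> (i :: nat) *s (n :: nat ^ 'k) \<noteq> 0"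
  by (auto simp: vec_eq_iff vector_scalar_mult_def)

lemma ex_nontrivial_loop:
  assumes "set_mset y \<subseteq> objs \<Lambda>" "y \<subseteq># sources n y" "y \<noteq> {#}" "n \<noteq> 0"
  shows "\<exists>\<mu>. nontrivial_loop \<Lambda> \<mu>"
proof -
  obtain w where "w \<in># y" using assms(3) by blast
  then obtain v i j where v: "v \<in># y" "i > 0" "v \<in># sources (i *s n) {#v#}"
    by (rule ex_loop_backwards[OF assms(1,2)])
  then obtain \<mu> where "is_loop \<Lambda> \<mu>" "deg \<Lambda> \<mu> = i *s n" using assms(1) ex_loopI by blast
  then show ?thesis using scaled_degree_nonzero[OF v(2) assms(4)]
    by (auto simp: nontrivial_loop_iff)
qed

text \<open>The multiset \<open>y\<close> is also fixed by the multiple \<open>i *s n\<close> that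
  is the degree of the loop found. Sizes cannot shrink on any part of \<open>y\<close>, so equality
  of the total sizes leaves exactly one path of that degree at each vertex, in particular at the
  base of the loop.\<close>

lemma ex_nontrivial_loop_without_entrance:
  assumes y: "set_mset y \<subseteq> objs \<Lambda>" and fixed: "sources n y = y" and "y \<noteq> {#}" "n \<noteq> 0"
  shows "\<exists>\<mu>. nontrivial_loop \<Lambda> \<mu> \<and> \<not> has_entrance \<Lambda> \<mu>"
proof -
  obtain w where "w \<in># y" using assms(3) by blast
  then obtain v i j where v: "v \<in># y" "i > 0" "v \<in># sources (i *s n) {#v#}"
    using ex_loop_backwards[OF y, of n w] fixed by (metis subset_mset.order_refl)
  then obtain \<mu> where \<mu>: "is_loop \<Lambda> \<mu>" "deg \<Lambda> \<mu> = i *s n" "rng \<Lambda> \<mu> = v"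
    using y ex_loopI by blast
  obtain z where z: "y = add_mset v z" using v(1) by (rule mset_add)
  have "size (sources (i *s n) {#v#}) + size (sources (i *s n) z) = 1 + size z"
    using sources_power_fixed[OF y fixed, of i] sources_add_mset[of "i *s n" v z]
    by (metis plus_1_eq_Suc size_add_mset size_union z)
  moreover have "1 \<le> size (sources (i *s n) {#v#})" "size z \<le> size (sources (i *s n) z)"
    using size_sources_ge[of "{#v#}"] size_sources_ge[of z] y z by auto
  ultimately have "size (sources (i *s n) {#v#}) = 1" by linarith
  then show ?thesis using \<mu> scaled_degree_nonzero[OF v(2) assms(4)]
    by (metis nontrivial_loop_iff not_has_entrance_iff_size)
qed

text \<open>If no loop has an entrance, then a vertex reached from a loop lies on that loop, so by
  walking backwards every vertex of \<open>y\<close> emits a single path of degree \<open>n\<close>.\<close>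

lemma ex_loop_with_entrance:
  assumes y: "set_mset y \<subseteq> objs \<Lambda>" and sub: "y \<subset># sources n y"
  shows "\<exists>\<mu>. is_loop \<Lambda> \<mu> \<and> has_entrance \<Lambda> \<mu>"
proof (rule ccontr)
  assume "\<not> ?thesis"
  then have no: "size (sources (deg \<Lambda> \<mu>) {#rng \<Lambda> \<mu>#}) = 1" if "is_loop \<Lambda> \<mu>" for \<mu>
    using that not_has_entrance_iff_size by blast
  have one: "size (sources n {#w#}) = 1" if "w \<in># y" for w
  proof -
    from that sub obtain v i j where v: "v \<in># y" "i > 0" "v \<in># sources (i *s n) {#v#}"
      and w: "w \<in># sources (j *s n) {#v#}"
      using ex_loop_backwards[OF y, of n w] by (auto simp: subset_mset.less_imp_le)
    have vo: "set_mset {#v#} \<subseteq> objs \<Lambda>" and wo: "set_mset {#w#} \<subseteq> objs \<Lambda>" using v(1) y that by auto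
    obtain \<mu> where \<mu>: "is_loop \<Lambda> \<mu>" "deg \<Lambda> \<mu> = i *s n" "rng \<Lambda> \<mu> = v"
      using v y ex_loopI by blast
    have fix_v: "sources (i *s n) {#v#} = {#v#}"
      using no[OF \<mu>(1)] \<mu> v(3) by (auto intro: sources_singleton_eqI)
    \<comment> \<open>Running \<open>j\<close> times around the loop covers degree
      \<open>j *s n\<close>. As this longer degree admits only one path from \<open>v\<close>, so
      does \<open>j *s n\<close>, and it must lead to \<open>w\<close>.\<close>
    have "j *s n \<le> j *s (i *s n)"
      using v(2) by (auto simp: less_eq_vec_def vector_scalar_mult_def)
    then have "size (sources (j *s n) {#v#}) \<le> 1"
      using size_sources_mono[OF vo] sources_power_fixed[OF vo fix_v, of j]
      by (metis size_single)
    then have to_w: "sources (j *s n) {#v#} = {#w#}"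
      using size_sources_ge[OF vo, of "j *s n"] w by (intro sources_singleton_eqI) auto
    \<comment> \<open>Path counting for the two degrees commutes, so the fixed vertex
      \<open>v\<close> passes its period on to \<open>w\<close>.\<close>
    have "sources (i *s n) {#w#} = {#w#}"
      using sources_sources[OF vo, of "i *s n" "j *s n"] sources_sources[OF vo, of "j *s n" "i *s n"]
      by (simp add: to_w fix_v add.commute)
    moreover have "n \<le> i *s n" using v(2) by (auto simp: less_eq_vec_def vector_scalar_mult_def)
    ultimately have "size (sources n {#w#}) \<le> 1"
      using size_sources_mono[OF wo] by (metis size_single)
    then show ?thesis using size_sources_ge[OF wo, of n] by simp
  qed
  \<comment> \<open>For \<open>z = y\<close> this contradicts the strict containment; the general
    form serves the induction.\<close>
  have "size (sources n z) = size z" if "z \<subseteq># y" for z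
    using that
  proof (induction z)
    case (add v z)
    then have "v \<in># y" "z \<subseteq># y"
      by (auto dest: mset_subset_eq_insertD subset_mset.less_imp_le)
    with add one show ?case by (simp add: sources_add_mset[of _ v z])
  qed (simp add: sources_empty)
  then show False using mset_subset_size[OF sub] by simp
qed

section \<open>The talented monoid as a direct limit\<close>

text \<open>\<open>expand M x\<close> rewrites every generator of \<open>x\<close> at level \<open>M\<close>; this is meaningful only if \<open>M\<close>
  is above all levels occurring in \<open>x\<close>, because \<open>vnat\<close> truncates.\<close>

definition expand :: "int ^ 'k \<Rightarrow> ('o \<times> (int ^ 'k)) multiset \<Rightarrow> 'o multiset" where
  "expand M x = (\<Sum>(v, n)\<in>#x. sources (vnat (M - n)) {#v#})"

definition place :: "int ^ 'k \<Rightarrow> 'o multiset \<Rightarrow> ('o \<times> (int ^ 'k)) multiset" where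
  "place M y = image_mset (\<lambda>v. (v, M)) y"

lemma expand_empty: "expand M {#} = {#}"
  by (simp add: expand_def)

lemma expand_union: "expand M (x + y) = expand M x + expand M y"
  by (simp add: expand_def)

lemma expand_add_mset: "expand M (add_mset (v, n) x) = sources (vnat (M - n)) {#v#} + expand M x"
  by (simp add: expand_def)

lemma expand_shift: "expand M (shift q x) = expand (M - q) x"
  by (simp add: expand_def shift_def multiset.map_comp comp_def case_prod_unfold algebra_simps)

lemma expand_place: "expand M (place L y) = sources (vnat (M - L)) y"
  by (simp add: expand_def place_def multiset.map_comp comp_def sources_def)

lemma expand_objs: "set_mset x \<subseteq> talented_gens \<Lambda> \<Longrightarrow> set_mset (expand M x) \<subseteq> objs \<Lambda>"
proof (induction x)
  case (add p x)
  obtain v n where p: "p = (v, n)" by force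
  then have "v \<in> objs \<Lambda>" using add by (auto simp: talented_gens_def)
  then show ?case
    using add sources_objs[of "{#v#}"] by (auto simp: p expand_add_mset)
qed (simp add: expand_empty)

lemma place_empty: "place M {#} = {#}"
  by (simp add: place_def)

lemma place_union: "place M (x + y) = place M x + place M y"
  by (simp add: place_def)

lemma place_shift: "shift q (place M y) = place (M + q) y"
  by (simp add: place_def shift_def multiset.map_comp comp_def)

lemma place_gens: "set_mset y \<subseteq> objs \<Lambda> \<Longrightarrow> set_mset (place M y) \<subseteq> talented_gens \<Lambda>"
  by (auto simp: place_def talented_gens_def)

lemma ex_vec_upper_bound: "\<exists>N :: int ^ 'k. a \<le> N \<and> b \<le> N"
  by (rule exI[of _ "\<chi> i. max (a $ i) (b $ i)"]) (auto simp: less_eq_vec_def)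

lemma ex_level_bound: "\<exists>N :: int ^ 'k. \<forall>p\<in>#x. snd p \<le> N"
proof (induction x)
  case (add p x)
  then show ?case by (metis ex_vec_upper_bound insert_iff order_trans set_mset_add_mset_insert)
qed simp

text \<open>Since \<open>M\<close> bounds all levels in \<open>x\<close>, no truncation occurs, and
  going from \<open>n\<close> to \<open>M + vint m\<close> can be done in two stages with a stop at
  \<open>M\<close>.\<close>

lemma expand_add_level:
  assumes "set_mset x \<subseteq> talented_gens \<Lambda>" "\<forall>p\<in>#x. snd p \<le> M"
  shows "expand (M + vint m) x = sources m (expand M x)"
  using assms
proof (induction x)
  case (add p x)
  obtain v n where p: "p = (v, n)" by force
  have v: "v \<in> objs \<Lambda>" "n \<le> M" using add.prems by (auto simp: talented_gens_def p)
  have "vnat (M + vint m - n) = vnat (M - n) + m"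
    using vnat_diff_add[of n m "M + vint m"] v(2) by (simp add: less_eq_vec_def add.commute)
  then show ?case
    using add v by (simp add: p expand_add_mset sources_union sources_sources)
qed (simp add: expand_empty sources_empty)

text \<open>High-level expansion is an invariant of the congruence. A defining relation only splits
  off a first step of degree \<open>axis i 1\<close>, which expansion absorbs; for transitivity a
  common upper bound of the two thresholds is taken.\<close>

lemma expand_cong:
  assumes "(x, y) \<in> talented_cong \<Lambda>"
  shows "\<exists>N. \<forall>M\<ge>N. expand M x = expand M y"
  using assms
proof (induction rule: pres_cong.induct)
  case (rel x y)
  then obtain v n i where v: "v \<in> objs \<Lambda>" "x = {#(v, n)#}" and
    "y = image_mset (\<lambda>\<alpha>. (src \<Lambda> \<alpha>, n + axis i 1)) (mset_set (paths_from \<Lambda> v (axis i 1)))"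
    unfolding talented_rels_def by blast
  then have y: "y = place (n + axis i 1) (sources (axis i 1) {#v#})"
    by (simp add: place_def sources_single_image multiset.map_comp comp_def)
  show ?case
  proof (intro exI allI impI)
    fix M assume "n + axis i 1 \<le> M"
    then have "vnat (M - n) = axis i 1 + vnat (M - (n + axis i 1))"
      using vnat_diff_add[of n "axis i 1" M] by (simp add: vint_axis del: One_nat_def)
    then show "expand M x = expand M y"
      using v(1) unfolding y expand_place
      by (simp add: v(2) expand_add_mset expand_empty sources_sources)
  qed
next
  case (trans x y z)
  then show ?case by (metis ex_vec_upper_bound order_trans)
next
  case (add x y z)
  then show ?case by (metis expand_union)
qed metis+

lemma place_sources_axis:
  assumes "set_mset y \<subseteq> objs \<Lambda>"
  shows "(place M y, place (M + axis i 1) (sources (axis i 1) y)) \<in> talented_cong \<Lambda>"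
  using assms
proof (induction y)
  case empty
  then show ?case by (simp add: place_empty sources_empty pres_cong.refl)
next
  case (add v y)
  have v: "v \<in> objs \<Lambda>" using add.prems by simp
  have "({#(v, M)#}, place (M + axis i 1) (sources (axis i 1) {#v#})) \<in> talented_cong \<Lambda>"
  proof (rule pres_cong.rel)
    show "({#(v, M)#}, place (M + axis i 1) (sources (axis i 1) {#v#})) \<in> talented_rels \<Lambda>"
      using v by (auto simp: talented_rels_def place_def sources_single_image multiset.map_comp comp_def)
    show "set_mset {#(v, M)#} \<subseteq> talented_gens \<Lambda>" using v by (simp add: talented_gens_def)
    show "set_mset (place (M + axis i 1) (sources (axis i 1) {#v#})) \<subseteq> talented_gens \<Lambda>"
      using v by (intro place_gens sources_objs) simp
  qed
  from pres_cong_add2[OF this add.IH] add.prems show ?case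
    by (simp add: sources_add_mset[of _ v y] place_union) (simp add: place_def)
qed

text \<open>The degree \<open>n\<close> is built up from unit vectors, and each of them applies a
  defining relation to all vertices of the current level at once.\<close>

lemma place_sources:
  assumes "set_mset y \<subseteq> objs \<Lambda>"
  shows "(place M y, place (M + vint n) (sources n y)) \<in> talented_cong \<Lambda>"
proof (induction n rule: vec_nat_induct)
  case 0
  then show ?case using assms by (simp add: vint_0 sources_0 pres_cong.refl place_gens)
next
  case (add n i)
  have "(place (M + vint n) (sources n y),
      place (M + vint n + axis i 1) (sources (axis i 1) (sources n y))) \<in> talented_cong \<Lambda>"
    using assms by (intro place_sources_axis sources_objs)
  then show ?case using pres_cong.trans[OF add]
    by (simp add: sources_sources[OF assms] vint_add vint_axis add.assoc del: One_nat_def)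
qed

text \<open>Existence of a one-level representative: each generator is pushed up to \<open>M\<close>
  separately. Together with \<open>expand_cong\<close> this is the direct limit description.\<close>

lemma place_expand:
  assumes "set_mset x \<subseteq> talented_gens \<Lambda>" "\<forall>p\<in>#x. snd p \<le> M"
  shows "(x, place M (expand M x)) \<in> talented_cong \<Lambda>"
  using assms
proof (induction x)
  case empty
  then show ?case by (simp add: place_empty expand_empty pres_cong.refl)
next
  case (add p x)
  obtain v n where p: "p = (v, n)" by force
  have v: "v \<in> objs \<Lambda>" "n \<le> M" using add.prems by (auto simp: talented_gens_def p)
  have "n + vint (vnat (M - n)) = M" using v(2) by (subst vint_vnat) (auto simp: less_eq_vec_def)
  then have "({#(v, n)#}, place M (sources (vnat (M - n)) {#v#})) \<in> talented_cong \<Lambda>"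
    using place_sources[of "{#v#}" n "vnat (M - n)"] v by (simp add: place_def)
  from pres_cong_add2[OF this add.IH] add.prems show ?case
    by (simp add: p expand_add_mset place_union)
qed

section \<open>Congruences between an element and its translate\<close>

text \<open>Take \<open>y = expand L x\<close> with \<open>L\<close> above all levels of
  \<open>x\<close> and above the threshold of \<open>expand_cong\<close>, and compare both sides at
  level \<open>L + vint n\<close>: the left one becomes \<open>sources n y\<close>, while the
  translate of \<open>x\<close> expands back to \<open>y\<close>. The remainder
  \<open>expand M z\<close> witnesses that \<open>y\<close> is contained in
  \<open>sources n y\<close>.\<close>

lemma cong_shift_addE:
  assumes x: "set_mset x \<subseteq> talented_gens \<Lambda>" and z: "set_mset z \<subseteq> talented_gens \<Lambda>"
    and cong: "(x, shift (vint n) x + z) \<in> talented_cong \<Lambda>"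
  obtains L y M where "set_mset y \<subseteq> objs \<Lambda>" "(x, place L y) \<in> talented_cong \<Lambda>"
    "sources n y = y + expand M z"
proof -
  obtain N where N: "\<And>M. N \<le> M \<Longrightarrow> expand M x = expand M (shift (vint n) x + z)"
    using expand_cong[OF cong] by blast
  obtain K where K: "\<forall>p\<in>#x. snd p \<le> K" using ex_level_bound by blast
  obtain L where L: "N \<le> L" "K \<le> L" using ex_vec_upper_bound by blast
  have KL: "\<forall>p\<in>#x. snd p \<le> L" using K L(2) order_trans by blast
  have "L \<le> L + vint n" using vint_nonneg[of n] by (auto simp: less_eq_vec_def)
  then have "expand (L + vint n) x = expand (L + vint n) (shift (vint n) x + z)"
    using N L(1) order_trans by blast
  then have "sources n (expand L x) = expand L x + expand (L + vint n) z"
    by (simp add: expand_add_level[OF x KL] expand_union expand_shift)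
  then show ?thesis using that expand_objs[OF x] place_expand[OF x KL] by blast
qed

text \<open>One path of degree \<open>n\<close> returning to \<open>v\<close> is set aside; the
  sources of the others form \<open>w\<close>, whose placement is the difference between
  \<open>v\<close> and its translate.\<close>

lemma vertex_shift_add:
  assumes "v \<in> objs \<Lambda>" "v \<in># sources n {#v#}"
  obtains w where "set_mset w \<subseteq> objs \<Lambda>" "sources n {#v#} = add_mset v w"
    "({#(v, 0)#}, shift (vint n) {#(v, 0)#} + place (vint n) w) \<in> talented_cong \<Lambda>"
proof -
  obtain w where w: "sources n {#v#} = add_mset v w" using assms(2) by (rule mset_add)
  moreover have "set_mset w \<subseteq> objs \<Lambda>"
    using sources_objs[of "{#v#}" n] assms(1) w by auto
  moreover have "({#(v, 0)#}, shift (vint n) {#(v, 0)#} + place (vint n) w) \<in> talented_cong \<Lambda>"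
    using place_sources[of "{#v#}" 0 n] assms(1) w by (simp add: place_def shift_def)
  ultimately show ?thesis using that by blast
qed

lemma place_cong_empty:
  assumes "set_mset y \<subseteq> objs \<Lambda>" "(place L y, {#}) \<in> talented_cong \<Lambda>"
  shows "y = {#}"
  using expand_cong[OF assms(2)] assms(1)
  by (auto simp: expand_place expand_empty sources_eq_empty_iff)

text \<open>At a high common level both sides contain the expansion of \<open>v\<close>. Cancelling
  it in the free monoid leaves the sources of \<open>w\<close> equal to the empty multiset, which
  forces \<open>w\<close> to be empty.\<close>

lemma vertex_shift_cong:
  assumes v: "v \<in> objs \<Lambda>" and w: "set_mset w \<subseteq> objs \<Lambda>" "sources n {#v#} = add_mset v w"
    and cong: "({#(v, 0)#}, shift (vint n) {#(v, 0)#}) \<in> talented_cong \<Lambda>"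
  shows "w = {#}"
proof -
  obtain N where N: "\<And>M. N \<le> M \<Longrightarrow> expand M {#(v, 0)#} = expand M (shift (vint n) {#(v, 0)#})"
    using expand_cong[OF cong] by blast
  obtain M where M: "N \<le> M" "vint n \<le> M" using ex_vec_upper_bound by blast
  let ?m = "vnat (M - vint n)"
  have "vnat M = n + ?m" using vnat_diff_add[of 0 n M] M(2) by simp
  then have "expand M {#(v, 0)#} = sources ?m (add_mset v w)"
    using sources_sources[of "{#v#}" ?m n] v by (simp add: expand_add_mset expand_empty w(2))
  moreover have "expand M (shift (vint n) {#(v, 0)#}) = sources ?m {#v#}"
    by (simp add: expand_shift expand_add_mset expand_empty)
  ultimately have "sources ?m w = {#}"
    using N[OF M(1)] by (simp add: sources_add_mset[of _ v w])
  then show ?thesis using sources_eq_empty_iff w(1) by blast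
qed

lemma loop_without_entrance_cong:
  assumes "is_loop \<Lambda> \<mu>" "\<not> has_entrance \<Lambda> \<mu>"
  shows "({#(rng \<Lambda> \<mu>, 0)#}, shift (vint (deg \<Lambda> \<mu>)) {#(rng \<Lambda> \<mu>, 0)#}) \<in> talented_cong \<Lambda>"
proof -
  obtain w where w: "sources (deg \<Lambda> \<mu>) {#rng \<Lambda> \<mu>#} = add_mset (rng \<Lambda> \<mu>) w"
    "({#(rng \<Lambda> \<mu>, 0)#}, shift (vint (deg \<Lambda> \<mu>)) {#(rng \<Lambda> \<mu>, 0)#} + place (vint (deg \<Lambda> \<mu>)) w)
      \<in> talented_cong \<Lambda>"
    using vertex_shift_add[OF loopD[OF assms(1)]] by blast
  moreover have "w = {#}" using w(1) assms(2) not_has_entrance_iff_size[OF assms(1)] by simp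
  ultimately show ?thesis by (simp add: place_empty)
qed

lemma singleton_gens: "v \<in> objs \<Lambda> \<Longrightarrow> set_mset {#(v, n)#} \<subseteq> talented_gens \<Lambda>"
  by (simp add: talented_gens_def)

lemma singleton_not_cong_empty:
  assumes "v \<in> objs \<Lambda>"
  shows "({#(v, n)#}, {#}) \<notin> talented_cong \<Lambda>"
  using place_cong_empty[of "{#v#}" n] assms by (auto simp: place_def)

section \<open>The three equivalences for representatives\<close>

lemma nontrivial_loop_without_entrance_iff:
  "(\<exists>\<mu>. nontrivial_loop \<Lambda> \<mu> \<and> \<not> has_entrance \<Lambda> \<mu>) \<longleftrightarrow>
   (\<exists>x n. set_mset x \<subseteq> talented_gens \<Lambda> \<and> (x, {#}) \<notin> talented_cong \<Lambda> \<and>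
      n \<le> 0 \<and> n \<noteq> 0 \<and> (shift n x, x) \<in> talented_cong \<Lambda>)" (is "?L \<longleftrightarrow> ?R")
proof
  assume ?L
  then obtain \<mu> where \<mu>: "is_loop \<Lambda> \<mu>" "deg \<Lambda> \<mu> \<noteq> 0" "\<not> has_entrance \<Lambda> \<mu>"
    by (auto simp: nontrivial_loop_iff)
  let ?n = "vint (deg \<Lambda> \<mu>)" and ?x = "{#(rng \<Lambda> \<mu>, 0)#}"
  have "(shift (- ?n) ?x, ?x) \<in> talented_cong \<Lambda>"
    using shift_cong[OF loop_without_entrance_cong[OF \<mu>(1,3)], of "- ?n"]
    by (simp add: shift_shift shift_0)
  moreover have "- ?n \<le> 0" "- ?n \<noteq> 0"
    using \<mu>(2) vint_eq_0_iff vint_nonneg[of "deg \<Lambda> \<mu>"] by (auto simp: less_eq_vec_def)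
  moreover have "set_mset ?x \<subseteq> talented_gens \<Lambda>" "(?x, {#}) \<notin> talented_cong \<Lambda>"
    using loopD(1)[OF \<mu>(1)] by (auto simp: talented_gens_def dest: singleton_not_cong_empty[unfolded talented_gens_def])
  ultimately show ?R by blast
next
  assume ?R
  then obtain x n where x: "set_mset x \<subseteq> talented_gens \<Lambda>" "(x, {#}) \<notin> talented_cong \<Lambda>"
    and n: "n \<le> 0" "n \<noteq> 0" and cong: "(shift n x, x) \<in> talented_cong \<Lambda>" by blast
  have m: "vint (vnat (- n)) = - n" using n(1) by (intro vint_vnat) (simp add: less_eq_vec_def)
  have empty: "set_mset {#} \<subseteq> talented_gens \<Lambda>" by simp
  \<comment> \<open>Translating by \<open>- n\<close> makes the exponent a degree of paths; the zero
    remainder \<open>{#}\<close> turns the containment of \<open>cong_shift_addE\<close> into an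
    equality.\<close>
  have "(x, shift (vint (vnat (- n))) x + {#}) \<in> talented_cong \<Lambda>"
    using shift_cong[OF cong, of "- n"] by (simp add: m shift_shift shift_0)
  then obtain L y M where y: "set_mset y \<subseteq> objs \<Lambda>" "(x, place L y) \<in> talented_cong \<Lambda>"
    "sources (vnat (- n)) y = y + expand M {#}"
    by (rule cong_shift_addE[OF x(1) empty])
  have "y \<noteq> {#}" using y(2) x(2) by (auto simp: place_empty)
  moreover have "vnat (- n) \<noteq> 0" using m n(2) by (auto simp: vint_0)
  ultimately show ?L
    using ex_nontrivial_loop_without_entrance[OF y(1)] y(3) by (simp add: expand_empty)
qed

text \<open>A loop gives \<open>z\<close> as the placement of the sources of the other paths of its
  range and degree. Conversely, containment of a nonempty \<open>y\<close> in
  \<open>sources (vnat n) y\<close> is enough for a backward walk.\<close>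

lemma nontrivial_loop_iff_cong:
  "(\<exists>\<mu>. nontrivial_loop \<Lambda> \<mu>) \<longleftrightarrow>
   (\<exists>x n z. set_mset x \<subseteq> talented_gens \<Lambda> \<and> set_mset z \<subseteq> talented_gens \<Lambda> \<and>
      (x, {#}) \<notin> talented_cong \<Lambda> \<and>
      0 \<le> n \<and> n \<noteq> 0 \<and> (x, shift n x + z) \<in> talented_cong \<Lambda>)" (is "?L \<longleftrightarrow> ?R")
proof
  assume ?L
  then obtain \<mu> where \<mu>: "is_loop \<Lambda> \<mu>" "deg \<Lambda> \<mu> \<noteq> 0" by (auto simp: nontrivial_loop_iff)
  let ?n = "vint (deg \<Lambda> \<mu>)" and ?x = "{#(rng \<Lambda> \<mu>, 0)#}"
  obtain w where "set_mset w \<subseteq> objs \<Lambda>" "(?x, shift ?n ?x + place ?n w) \<in> talented_cong \<Lambda>"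
    using vertex_shift_add[OF loopD[OF \<mu>(1)]] by blast
  moreover have "set_mset ?x \<subseteq> talented_gens \<Lambda>" "(?x, {#}) \<notin> talented_cong \<Lambda>"
    using loopD(1)[OF \<mu>(1)] by (auto simp: talented_gens_def dest: singleton_not_cong_empty[unfolded talented_gens_def])
  moreover have "0 \<le> ?n" "?n \<noteq> 0" using \<mu>(2) by (auto simp: vint_nonneg vint_eq_0_iff)
  ultimately show ?R using place_gens by blast
next
  assume ?R
  then obtain x n z where x: "set_mset x \<subseteq> talented_gens \<Lambda>" "(x, {#}) \<notin> talented_cong \<Lambda>"
    and z: "set_mset z \<subseteq> talented_gens \<Lambda>"
    and n: "0 \<le> n" "n \<noteq> 0" and cong: "(x, shift n x + z) \<in> talented_cong \<Lambda>" by blast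
  have "(x, shift (vint (vnat n)) x + z) \<in> talented_cong \<Lambda>" using cong n(1) by (simp add: vint_vnat)
  then obtain L y M where y: "set_mset y \<subseteq> objs \<Lambda>" "(x, place L y) \<in> talented_cong \<Lambda>"
    "sources (vnat n) y = y + expand M z"
    by (rule cong_shift_addE[OF x(1) z])
  have "y \<noteq> {#}" using y(2) x(2) by (auto simp: place_empty)
  moreover have "vnat n \<noteq> 0" using vint_vnat[OF n(1)] n(2) by (auto simp: vint_0)
  ultimately show ?L
    using ex_nontrivial_loop[OF y(1), of "vnat n"] y(3) by simp
qed

lemma loop_with_entrance_iff:
  "(\<exists>\<mu>. is_loop \<Lambda> \<mu> \<and> has_entrance \<Lambda> \<mu>) \<longleftrightarrow>
   (\<exists>x n z. set_mset x \<subseteq> talented_gens \<Lambda> \<and> set_mset z \<subseteq> talented_gens \<Lambda> \<and>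
      0 \<le> n \<and> (x, shift n x + z) \<in> talented_cong \<Lambda> \<and>
      (shift n x, x) \<notin> talented_cong \<Lambda>)" (is "?L \<longleftrightarrow> ?R")
proof
  assume ?L
  then obtain \<mu> where \<mu>: "is_loop \<Lambda> \<mu>" "has_entrance \<Lambda> \<mu>" by blast
  let ?n = "vint (deg \<Lambda> \<mu>)" and ?x = "{#(rng \<Lambda> \<mu>, 0)#}"
  obtain w where w: "set_mset w \<subseteq> objs \<Lambda>"
      "sources (deg \<Lambda> \<mu>) {#rng \<Lambda> \<mu>#} = add_mset (rng \<Lambda> \<mu>) w"
      "(?x, shift ?n ?x + place ?n w) \<in> talented_cong \<Lambda>"
    using vertex_shift_add[OF loopD[OF \<mu>(1)]] by blast
  have "w \<noteq> {#}" using w(2) \<mu>(2) not_has_entrance_iff_size[OF \<mu>(1)] by auto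
  then have "(shift ?n ?x, ?x) \<notin> talented_cong \<Lambda>"
    using vertex_shift_cong[OF loopD(1)[OF \<mu>(1)] w(1,2)] pres_cong.sym by blast
  moreover have "set_mset ?x \<subseteq> talented_gens \<Lambda>"
    using loopD(1)[OF \<mu>(1)] by (rule singleton_gens)
  ultimately show ?R using place_gens[OF w(1)] w(3) vint_nonneg[of "deg \<Lambda> \<mu>"] by blast
next
  assume ?R
  then obtain x n z where x: "set_mset x \<subseteq> talented_gens \<Lambda>" "(shift n x, x) \<notin> talented_cong \<Lambda>"
    and z: "set_mset z \<subseteq> talented_gens \<Lambda>"
    and n: "0 \<le> n" and cong: "(x, shift n x + z) \<in> talented_cong \<Lambda>" by blast
  have "(x, shift (vint (vnat n)) x + z) \<in> talented_cong \<Lambda>" using cong n by (simp add: vint_vnat)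
  then obtain L y M where y: "set_mset y \<subseteq> objs \<Lambda>" "(x, place L y) \<in> talented_cong \<Lambda>"
    "sources (vnat n) y = y + expand M z"
    by (rule cong_shift_addE[OF x(1) z])
  \<comment> \<open>Otherwise \<open>y\<close> at level \<open>L\<close> would be congruent to
    \<open>y\<close> at level \<open>L + n\<close>, making \<open>x\<close> congruent to its own
    translate.\<close>
  have "sources (vnat n) y \<noteq> y"
  proof
    assume "sources (vnat n) y = y"
    then have "(place L y, place (L + n) y) \<in> talented_cong \<Lambda>"
      using place_sources[OF y(1), of L "vnat n"] n by (simp add: vint_vnat)
    moreover have "(shift n x, place (L + n) y) \<in> talented_cong \<Lambda>"
      using shift_cong[OF y(2), of n] by (simp add: place_shift)
    ultimately have "(shift n x, x) \<in> talented_cong \<Lambda>"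
      using y(2) pres_cong.sym pres_cong.trans by metis
    then show False using x(2) by blast
  qed
  then have "y \<subset># sources (vnat n) y"
    using y(3) by (auto simp: subset_mset_def)
  then show ?L by (rule ex_loop_with_entrance[OF y(1)])
qed

end

section \<open>Passage from representatives to classes\<close>

lemma talented_class_eq_iff:
  assumes "set_mset x \<subseteq> talented_gens \<Lambda>" "set_mset y \<subseteq> talented_gens \<Lambda>"
  shows "talented_cong \<Lambda> `` {x} = talented_cong \<Lambda> `` {y} \<longleftrightarrow> (x, y) \<in> talented_cong \<Lambda>"
  using assms by (intro eq_equiv_class_iff[OF equiv_pres_cong]) auto

lemma bex_talented_carrier:
  "(\<exists>a\<in>carrier (talented_monoid \<Lambda>). P a) \<longleftrightarrow>
   (\<exists>x. set_mset x \<subseteq> talented_gens \<Lambda> \<and> P (talented_cong \<Lambda> `` {x}))"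
  unfolding talented_monoid_def by (metis pres_carrierE pres_carrierI)

lemma talented_class_eq_one_iff:
  assumes "set_mset x \<subseteq> talented_gens \<Lambda>"
  shows "talented_cong \<Lambda> `` {x} = \<one>\<^bsub>talented_monoid \<Lambda>\<^esub> \<longleftrightarrow> (x, {#}) \<in> talented_cong \<Lambda>"
  unfolding talented_monoid_def pres_one using assms by (intro talented_class_eq_iff) auto

lemma talented_act_eq_iff:
  assumes "set_mset x \<subseteq> talented_gens \<Lambda>"
  shows "talented_act \<Lambda> n (talented_cong \<Lambda> `` {x}) = talented_cong \<Lambda> `` {x} \<longleftrightarrow>
    (shift n x, x) \<in> talented_cong \<Lambda>"
  using assms by (simp add: talented_act_class talented_class_eq_iff shift_gens del: Image_singleton_iff)

lemma talented_act_le_iff: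
  assumes "set_mset x \<subseteq> talented_gens \<Lambda>"
  shows "alg_le (talented_monoid \<Lambda>) (talented_act \<Lambda> n (talented_cong \<Lambda> `` {x})) (talented_cong \<Lambda> `` {x})
    \<longleftrightarrow> (\<exists>z. set_mset z \<subseteq> talented_gens \<Lambda> \<and> (x, shift n x + z) \<in> talented_cong \<Lambda>)"
proof -
  have "talented_cong \<Lambda> `` {x} = talented_cong \<Lambda> `` {shift n x} \<otimes>\<^bsub>talented_monoid \<Lambda>\<^esub> talented_cong \<Lambda> `` {z}
      \<longleftrightarrow> (x, shift n x + z) \<in> talented_cong \<Lambda>" if "set_mset z \<subseteq> talented_gens \<Lambda>" for z
  proof -
    have "set_mset (shift n x + z) \<subseteq> talented_gens \<Lambda>"
      using that shift_gens[OF assms, of n] by simp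
    then show ?thesis
      using talented_class_eq_iff[OF assms] pres_mult_class[OF shift_gens[OF assms] that]
      by (simp add: talented_monoid_def del: Image_singleton_iff)
  qed
  then show ?thesis
    unfolding alg_le_def bex_talented_carrier talented_act_class[OF assms] by blast
qed

theorem theorem4p1p3:
  fixes \<Lambda> :: "('o, 'm, 'k::finite) kgraph"
  assumes "k_graph \<Lambda>"
    and "row_finite_without_sources \<Lambda>"
  shows
    "((\<exists>\<mu>. nontrivial_loop \<Lambda> \<mu> \<and> \<not> has_entrance \<Lambda> \<mu>) \<longleftrightarrow>
       (\<exists>a \<in> carrier (talented_monoid \<Lambda>). \<exists>n :: int ^ 'k.
          a \<noteq> \<one>\<^bsub>talented_monoid \<Lambda>\<^esub> \<and> n \<le> 0 \<and> n \<noteq> 0 \<and> talented_act \<Lambda> n a = a))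
   \<and> ((\<exists>\<mu>. is_loop \<Lambda> \<mu> \<and> has_entrance \<Lambda> \<mu>) \<longleftrightarrow>
       (\<exists>a \<in> carrier (talented_monoid \<Lambda>). \<exists>n :: int ^ 'k.
          0 \<le> n \<and> alg_less (talented_monoid \<Lambda>) (talented_act \<Lambda> n a) a))
   \<and> ((\<exists>\<mu>. nontrivial_loop \<Lambda> \<mu>) \<longleftrightarrow>
       (\<exists>a \<in> carrier (talented_monoid \<Lambda>). \<exists>n :: int ^ 'k.
          a \<noteq> \<one>\<^bsub>talented_monoid \<Lambda>\<^esub> \<and> 0 \<le> n \<and> n \<noteq> 0 \<and>
          alg_le (talented_monoid \<Lambda>) (talented_act \<Lambda> n a) a))"
proof -
  interpret k_graph \<Lambda> by fact
  interpret row_finite_k_graph \<Lambda> by unfold_locales fact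
  \<comment> \<open>Quantifiers over classes become quantifiers over representatives, which matches
    the three equivalences above.\<close>
  show ?thesis
    unfolding bex_talented_carrier alg_less_def nontrivial_loop_without_entrance_iff
      loop_with_entrance_iff nontrivial_loop_iff_cong
    by (intro conjI; simp add: talented_class_eq_one_iff talented_act_eq_iff talented_act_le_iff
        del: Image_singleton_iff cong: conj_cong; blast)
qed

end
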